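(* Tight GFG-NSWs are co-Büchi-type: every tight GFG-NSW $\mathcal{A}=\langle\Sigma,Q,Q_0,\delta,\alpha\rangle$ whose language is recognized by some GFG-NCW has an equivalent GFG-NCW on the same structure, i.e. there is a set $\alpha'\subseteq Q$ such that $\langle\Sigma,Q,Q_0,\delta,\alpha'\rangle$, viewed as a co-Büchi automaton, is GFG and recognizes $L(\mathcal{A})$.
   Context: An automaton $\langle\Sigma,Q,Q_0,\delta,\alpha\rangle$ has $\delta:Q\times\Sigma\to2^Q$; runs are $r_0r_1\cdots$ with $r_0\in Q_0$, $r_{i+1}\in\delta(r_i,a_{i+1})$, accepting if the set $\inf(r)$ of infinitely visited states satisfies $\alpha$. Co-Büchi ($\alpha\subseteq Q$): $S$ accepting iff $S\cap\alpha=\emptyset$. Streett ($\alpha$ a set of pairs $\langle E,F\rangle$): $S$ accepting iff for every pair $S\cap E=\emptyset$ or $S\cap F\neq\emptyset$. NSW/NCW: nondeterministic Streett/co-Büchi word automaton. $\mathcal{A}$ is GFG if there is a strategy $g:\Sigma^*\to Q$ such that for every $w=a_1a_2\cdots$, $g(\epsilon),g(a_1),g(a_1a_2),\ldots$ is a run on $w$, accepting whenever $w\in L(\mathcal{A})$. Finite-state strategies are transducers $g=\langle\Sigma,Q,M,m_0,\rho,\tau\rangle$ (finite memories $M$, $\rho:M\times\Sigma\to M$ extended to words from $m_0$, $\tau:M\to Q$, $g(u)=\tau(\rho(u))$); $m$ is a memory of $q$ if $\tau(m)=q$. $\mathcal{A}_g=\langle\Sigma,M,m_0,\rho,\alpha_g\rangle$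 where $\alpha_g$ replaces each set $F$ in $\alpha$ by $\{m\mid\tau(m)\in F\}$. A transition $\langle q,a,q'\rangle$ is used by $g$ if $q=g(u)$, $q'=g(ua)$ for some $u$. For a set $P$ of finite paths, a combination is the union of state sets of a nonempty subset of $P$. For memories $m\neq m'$ with $\tau(m)=\tau(m')$, $m$ is replaceable by $m'$ if the set of paths of $\mathcal{A}_g$ from $m'$ to $m$ is empty or all its combinations are accepting w.r.t. $\alpha_g$. $\mathcal{A}$ is tight if for some finite-state strategy $g$ witnessing its GFGness, every transition of $\mathcal{A}$ is used by $g$ and no memory is replaceable by a different memory of the same state. *)

theory Defs
  imports Main
begin

(* An automaton <Sigma,Q,Q0,delta,alpha> is represented by its components;
   alpha is represented through an acceptance predicate on sets of states. *)

definition wf_aut :: "'a set \<Rightarrow> 'q set \<Rightarrow> 'q set \<Rightarrow> ('q \<Rightarrow> 'a \<Rightarrow> 'q set) \<Rightarrow> bool" where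
  "wf_aut Sig Q Q0 delta \<longleftrightarrow> finite Sig \<and> finite Q \<and> Q0 \<subseteq> Q \<and>
     (\<forall>q\<in>Q. \<forall>a\<in>Sig. delta q a \<subseteq> Q)"

(* infinite word w = a_1 a_2 ... is w 0, w 1, ... ; run r_0 r_1 ... *)
definition is_run :: "'q set \<Rightarrow> ('q \<Rightarrow> 'a \<Rightarrow> 'q set) \<Rightarrow> (nat \<Rightarrow> 'a) \<Rightarrow> (nat \<Rightarrow> 'q) \<Rightarrow> bool" where
  "is_run Q0 delta w r \<longleftrightarrow> r 0 \<in> Q0 \<and> (\<forall>i. r (Suc i) \<in> delta (r i) (w i))"

definition inf_set :: "(nat \<Rightarrow> 'q) \<Rightarrow> 'q set" where
  "inf_set r = {q. \<exists>\<^sub>\<infinity>i. r i = q}"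

definition streett_acc :: "('q set \<times> 'q set) set \<Rightarrow> 'q set \<Rightarrow> bool" where
  "streett_acc alpha S \<longleftrightarrow> (\<forall>(E, F)\<in>alpha. S \<inter> E = {} \<or> S \<inter> F \<noteq> {})"

definition cobuchi_acc :: "'q set \<Rightarrow> 'q set \<Rightarrow> bool" where
  "cobuchi_acc alpha S \<longleftrightarrow> S \<inter> alpha = {}"

definition lang :: "'a set \<Rightarrow> 'q set \<Rightarrow> ('q \<Rightarrow> 'a \<Rightarrow> 'q set) \<Rightarrow> ('q set \<Rightarrow> bool) \<Rightarrow> (nat \<Rightarrow> 'a) set" where
  "lang Sig Q0 delta acc =
     {w. (\<forall>i. w i \<in> Sig) \<and> (\<exists>r. is_run Q0 delta w r \<and> acc (inf_set r))}"

definition pref :: "(nat \<Rightarrow> 'a) \<Rightarrow> nat \<Rightarrow> 'a list" where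
  "pref w i = map w [0..<i]"

definition is_gfg_strategy :: "'a set \<Rightarrow> 'q set \<Rightarrow> ('q \<Rightarrow> 'a \<Rightarrow> 'q set) \<Rightarrow> ('q set \<Rightarrow> bool)
    \<Rightarrow> ('a list \<Rightarrow> 'q) \<Rightarrow> bool" where
  "is_gfg_strategy Sig Q0 delta acc g \<longleftrightarrow>
     (\<forall>w. (\<forall>i. w i \<in> Sig) \<longrightarrow>
        is_run Q0 delta w (\<lambda>i. g (pref w i)) \<and>
        (w \<in> lang Sig Q0 delta acc \<longrightarrow> acc (inf_set (\<lambda>i. g (pref w i)))))"

definition gfg :: "'a set \<Rightarrow> 'q set \<Rightarrow> ('q \<Rightarrow> 'a \<Rightarrow> 'q set) \<Rightarrow> ('q set \<Rightarrow> bool) \<Rightarrow> bool" where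
  "gfg Sig Q0 delta acc \<longleftrightarrow> (\<exists>g. is_gfg_strategy Sig Q0 delta acc g)"

(* finite-state strategies: transducers <Sigma,Q,M,m0,rho,tau>, memories encoded as naturals *)
definition transducer :: "'a set \<Rightarrow> 'q set \<Rightarrow> nat set \<Rightarrow> nat \<Rightarrow> (nat \<Rightarrow> 'a \<Rightarrow> nat) \<Rightarrow> (nat \<Rightarrow> 'q) \<Rightarrow> bool" where
  "transducer Sig Q M m0 rho tau \<longleftrightarrow> finite M \<and> m0 \<in> M \<and>
     (\<forall>m\<in>M. \<forall>a\<in>Sig. rho m a \<in> M) \<and> (\<forall>m\<in>M. tau m \<in> Q)"

definition strat :: "nat \<Rightarrow> (nat \<Rightarrow> 'a \<Rightarrow> nat) \<Rightarrow> (nat \<Rightarrow> 'q) \<Rightarrow> 'a list \<Rightarrow> 'q" where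
  "strat m0 rho tau u = tau (foldl rho m0 u)"

definition alpha_g :: "nat set \<Rightarrow> (nat \<Rightarrow> 'q) \<Rightarrow> ('q set \<times> 'q set) set \<Rightarrow> (nat set \<times> nat set) set" where
  "alpha_g M tau alpha = (\<lambda>(E, F). ({m\<in>M. tau m \<in> E}, {m\<in>M. tau m \<in> F})) ` alpha"

definition mem_path :: "'a set \<Rightarrow> (nat \<Rightarrow> 'a \<Rightarrow> nat) \<Rightarrow> nat list \<Rightarrow> nat \<Rightarrow> nat \<Rightarrow> bool" where
  "mem_path Sig rho p m' m \<longleftrightarrow> p \<noteq> [] \<and> hd p = m' \<and> last p = m \<and>
     (\<forall>i. Suc i < length p \<longrightarrow> (\<exists>a\<in>Sig. p ! Suc i = rho (p ! i) a))"

definition replaceable :: "'a set \<Rightarrow> ('q set \<times> 'q set) set \<Rightarrow> nat set \<Rightarrow> (nat \<Rightarrow> 'a \<Rightarrow> nat)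
    \<Rightarrow> (nat \<Rightarrow> 'q) \<Rightarrow> nat \<Rightarrow> nat \<Rightarrow> bool" where
  "replaceable Sig alpha M rho tau m m' \<longleftrightarrow> m \<noteq> m' \<and> tau m = tau m' \<and>
     ({p. mem_path Sig rho p m' m} = {} \<or>
      (\<forall>P. P \<subseteq> {p. mem_path Sig rho p m' m} \<and> P \<noteq> {} \<longrightarrow>
         streett_acc (alpha_g M tau alpha) (\<Union>p\<in>P. set p)))"

definition tight :: "'a set \<Rightarrow> 'q set \<Rightarrow> 'q set \<Rightarrow> ('q \<Rightarrow> 'a \<Rightarrow> 'q set) \<Rightarrow> ('q set \<times> 'q set) set \<Rightarrow> bool" where
  "tight Sig Q Q0 delta alpha \<longleftrightarrow>
    (\<exists>M m0 rho tau. transducer Sig Q M m0 rho tau \<and>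
       is_gfg_strategy Sig Q0 delta (streett_acc alpha) (strat m0 rho tau) \<and>
       (\<forall>q\<in>Q. \<forall>a\<in>Sig. \<forall>q'\<in>delta q a. \<exists>u. set u \<subseteq> Sig \<and>
           strat m0 rho tau u = q \<and> strat m0 rho tau (u @ [a]) = q') \<and>
       (\<forall>m\<in>M. \<forall>m'\<in>M. m \<noteq> m' \<and> tau m = tau m' \<longrightarrow> \<not> replaceable Sig alpha M rho tau m m'))"

end

theory Submission
  imports Defs "HOL-Library.Omega_Words_Fun"
begin

text \<open>
  Take for the co-Buechi condition the states that lie on no Streett-accepting loop of the automaton.
  Runs of the strategy on words of the language then stay accepting. Conversely, suppose a
  co-Buechi-accepting run exists on a rejected word. Following it together with the memory of the
  strategy up to a repetition yields a rejected lasso word, with a loop on v from a state q through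
  states that all lie on accepting loops. Inserting these loops as detours gives a loop on
  some word c whose state set is accepting and contains that of the loop on v, so all words
  (v^N c)^omega are accepted from q. An NCW for the language must, for large N, repeat a state inside
  a block v^N that avoids the co-Buechi set, so some (v^N c)^k v^omega is accepted from q as well.
  As the strategy uses every transition, moving along a transition preserves residual languages,
  and hence v^omega is accepted from q: a contradiction.
\<close>

section \<open>Infinite words\<close>

lemma inf_set_eq_limit: "inf_set r = limit r"
  by (simp add: inf_set_def limit_def)

lemma pref_eq_prefix: "pref w i = prefix i w"
  by (simp add: pref_def subsequence_def)

text \<open>With finite range, the limit is the whole range of some suffix, and images commute with
  ranges. With infinite range, \<open>f\<close> could merge values that each occur only finitely
  often.\<close>

lemma limit_comp_finite:
  assumes "finite (range x)"
  shows "limit (f \<circ> x) = f ` limit x"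
proof
  show "f ` limit x \<subseteq> limit (f \<circ> x)" by auto
  obtain k where k: "limit x = range (suffix k x)"
    using limit_is_suffix[OF assms] by blast
  have "limit (f \<circ> x) \<subseteq> range (suffix k (f \<circ> x))" by (rule limit_in_range_suffix)
  also have "\<dots> = f ` limit x" by (auto simp: k)
  finally show "limit (f \<circ> x) \<subseteq> f ` limit x" .
qed

text \<open>Start at an occurrence of \<open>a\<close> where only recurring values are left, and
  stop at an occurrence of \<open>a\<close> after every recurring value has been seen.\<close>

lemma limit_return:
  assumes fin: "finite (range x)" and a: "a \<in> limit x"
  obtains i j where "i < j" "x i = a" "x j = a" "x ` {i..<j} = limit x"
proof -
  obtain k where k: "limit x = range (suffix k x)"
    using limit_is_suffix[OF fin] by blast
  obtain i where i: "i \<ge> k" "x i = a"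
    using a unfolding limit_iff_frequent INFM_nat_le by blast
  have lim: "limit x = range (suffix i x)"
    using limit_range_suffix_incr[OF k i(1)] .
  have "finite (limit x)" using finite_subset[OF limit_in_range fin] .
  have "\<exists>n\<ge>i. x n = b" if "b \<in> limit x" for b
    using that unfolding limit_iff_frequent INFM_nat_le by blast
  \<comment> \<open>One occurrence at or after \<open>i\<close> of each recurring value; a
    \<open>j\<close> beyond their bound \<open>B\<close> closes a window containing them
    all.\<close>
  then obtain h where h: "\<And>b. b \<in> limit x \<Longrightarrow> h b \<ge> i \<and> x (h b) = b" by metis
  have "finite (h ` limit x)" using \<open>finite (limit x)\<close> by simp
  then obtain B where B: "\<forall>n\<in>h ` limit x. n < B" unfolding finite_nat_set_iff_bounded by blast
  obtain j where j: "j > max i B" "x j = a"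
    using a unfolding limit_iff_frequent INFM_nat by blast
  have "limit x \<subseteq> x ` {i..<j}"
  proof
    fix b assume "b \<in> limit x"
    then have "i \<le> h b" "h b < j" "x (h b) = b" using h[of b] B j(1) by auto
    then show "b \<in> x ` {i..<j}" by (intro image_eqI[of b x "h b"]) auto
  qed
  moreover have "x ` {i..<j} \<subseteq> limit x"
  proof
    fix b assume "b \<in> x ` {i..<j}"
    then obtain n where "i \<le> n" "b = x n" by auto
    then have "b = suffix i x (n - i)" by simp
    then show "b \<in> limit x" unfolding lim by blast
  qed
  ultimately show thesis using that[of i j] i(2) j by simp
qed

text \<open>The equation fixes the first letters and shifts every later position back by the length
  of \<open>v\<close>, so strong induction on the position applies.\<close>

lemma iter_unique:
  assumes "v \<noteq> []" "w = v \<frown> w"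
  shows "w = v\<^sup>\<omega>"
proof
  fix n show "w n = v\<^sup>\<omega> n"
  proof (induction n rule: less_induct)
    case (less n)
    have e: "w n = (v \<frown> w) n" using assms(2) by simp
    show ?case
    proof (cases "n < length v")
      case True then show ?thesis using e assms(1) by simp
    next
      case False
      then have "w n = w (n - length v)" using e by simp
      moreover have "n - length v < n"
        using False assms(1) by (cases v) auto
      ultimately show ?thesis using less[of "n - length v"] False assms(1)
        by (simp add: le_mod_geq)
    qed
  qed
qed

lemma pow_conc_iter:
  assumes "v \<noteq> []"
  shows "concat (replicate n v) \<frown> v\<^sup>\<omega> = v\<^sup>\<omega>"
proof (induction n)
  case (Suc n)
  have "concat (replicate (Suc n) v) \<frown> v\<^sup>\<omega> = v \<frown> concat (replicate n v) \<frown> v\<^sup>\<omega>"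
    by (simp del: conc_conc add: conc_conc[symmetric])
  then show ?case using Suc iter_unroll[of v] assms by (metis length_greater_0_conv)
qed simp

lemma iter_pow:
  assumes "v \<noteq> []" "n > 0"
  shows "(concat (replicate n v))\<^sup>\<omega> = v\<^sup>\<omega>"
  using iter_unique[of "concat (replicate n v)" "v\<^sup>\<omega>"] pow_conc_iter[OF assms(1), of n] assms
  by (cases n) auto

lemma range_iter:
  assumes "v \<noteq> []"
  shows "range (v\<^sup>\<omega>) = set v"
proof -
  have "range (v\<^sup>\<omega>) \<subseteq> set v" using assms by auto
  moreover have "set v \<subseteq> range (v\<^sup>\<omega>)" using limit_in_range[of "v\<^sup>\<omega>"] assms by simp
  ultimately show ?thesis by blast
qed

section \<open>Finite paths, runs and lassos\<close>

text \<open>Each entry holds the source state and the letter of a transition; the final state is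
  only the argument \<open>q'\<close>. Hence the first components of a nonempty loop are exactly the
  states that its infinite repetition visits.\<close>

fun path :: "('q \<Rightarrow> 'a \<Rightarrow> 'q set) \<Rightarrow> 'q \<Rightarrow> ('q \<times> 'a) list \<Rightarrow> 'q \<Rightarrow> bool" where
  "path delta q [] q' \<longleftrightarrow> q = q'"
| "path delta q ((p, a) # es) q' \<longleftrightarrow> p = q \<and> (\<exists>s\<in>delta q a. path delta s es q')"

lemma path_append: "path delta q (xs @ ys) q' \<longleftrightarrow> (\<exists>p. path delta q xs p \<and> path delta p ys q')"
  by (induction delta q xs q' arbitrary: rule: path.induct) auto

lemma path_pow: "path delta q es q \<Longrightarrow> path delta q (concat (replicate n es)) q"
  by (induction n) (auto simp: path_append)

lemma path_hd: "path delta q es q' \<Longrightarrow> es \<noteq> [] \<Longrightarrow> fst (es ! 0) = q"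
  by (cases es) auto

lemma path_nth:
  "path delta q es q' \<Longrightarrow> n < length es \<Longrightarrow>
     (if Suc n < length es then fst (es ! Suc n) else q') \<in> delta (fst (es ! n)) (snd (es ! n))"
proof (induction es arbitrary: q n)
  case (Cons e es)
  obtain p a where e: "e = (p, a)" by force
  with Cons.prems obtain s where s: "p = q" "s \<in> delta q a" "path delta s es q'" by auto
  show ?case
  proof (cases n)
    case 0
    then show ?thesis using e s path_hd[of delta s es q'] by (cases es) auto
  next
    case (Suc m)
    then show ?thesis using Cons.IH[OF s(3), of m] Cons.prems by auto
  qed
qed simp

lemma is_run_build:
  assumes "s \<in> delta q a" "is_run {s} delta w r"
  shows "is_run {q} delta (a ## w) (q ## r)"
  unfolding is_run_def
proof (intro conjI allI)
  fix i show "(q ## r) (Suc i) \<in> delta ((q ## r) i) ((a ## w) i)"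
    using assms by (cases i) (auto simp: is_run_def)
qed simp

lemma path_conc_run:
  "path delta q es q' \<Longrightarrow> is_run {q'} delta w r \<Longrightarrow>
     is_run {q} delta (map snd es \<frown> w) (map fst es \<frown> r)"
proof (induction es arbitrary: q)
  case (Cons e es)
  then show ?case by (cases e) (auto intro!: is_run_build)
qed simp

lemma path_omega:
  assumes p: "path delta q es q" and ne: "es \<noteq> []"
  shows "is_run {q} delta ((map snd es)\<^sup>\<omega>) ((map fst es)\<^sup>\<omega>)"
  unfolding is_run_def
proof (intro conjI allI)
  show "(map fst es)\<^sup>\<omega> 0 \<in> {q}" using path_hd[OF p ne] ne by simp
  fix i
  have l: "i mod length es < length es" using ne by simp
  \<comment> \<open>At the last transition the index wraps around to 0, where the state is
    \<open>q\<close> again because the path is closed.\<close>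
  then consider "Suc (i mod length es) = length es" | "Suc (i mod length es) < length es" by linarith
  then   show "(map fst es)\<^sup>\<omega> (Suc i) \<in> delta ((map fst es)\<^sup>\<omega> i) ((map snd es)\<^sup>\<omega> i)"
    by cases (use path_nth[OF p l] path_hd[OF p ne] ne in \<open>simp_all add: mod_Suc\<close>)
qed

abbreviation labelled :: "(nat \<Rightarrow> 'q) \<Rightarrow> (nat \<Rightarrow> 'a) \<Rightarrow> nat \<Rightarrow> 'q \<times> 'a" where
  "labelled r w \<equiv> \<lambda>n. (r n, w n)"

lemma map_subsequence: "map f (x [i \<rightarrow> j]) = (f \<circ> x) [i \<rightarrow> j]"
  by (simp add: subsequence_def)

lemma labels_subsequence [simp]:
  "map fst ((labelled r w) [i \<rightarrow> j]) = r [i \<rightarrow> j]"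
  "map snd ((labelled r w) [i \<rightarrow> j]) = w [i \<rightarrow> j]"
  by (simp_all add: map_subsequence comp_def)

lemma run_segment_path:
  assumes "is_run Q0 delta w r" "i \<le> j"
  shows "path delta (r i) ((labelled r w) [i \<rightarrow> j]) (r j)"
  using assms(2)
proof (induction j rule: dec_induct)
  case (step j)
  then show ?case using assms(1) by (auto simp: path_append is_run_def)
qed simp

text \<open>A repeated state closes the segment in between to a loop. This serves both for runs of
  the co-Buechi automaton and for the memory of the strategy, seen as a deterministic
  automaton.\<close>

lemma run_lasso:
  assumes "is_run Q0 delta w r" "i < j" "r i = r j"
  shows "is_run {r 0} delta (w [0 \<rightarrow> i] \<frown> (w [i \<rightarrow> j])\<^sup>\<omega>) (r [0 \<rightarrow> i] \<frown> (r [i \<rightarrow> j])\<^sup>\<omega>)"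
proof -
  have "path delta (r i) ((labelled r w) [i \<rightarrow> j]) (r i)"
    using run_segment_path[OF assms(1), of i j] assms(2,3) by simp
  then have "is_run {r i} delta ((w [i \<rightarrow> j])\<^sup>\<omega>) ((r [i \<rightarrow> j])\<^sup>\<omega>)"
    using path_omega[of delta "r i" "(labelled r w) [i \<rightarrow> j]"] assms(2) by simp
  then show ?thesis
    using path_conc_run[OF run_segment_path[OF assms(1), of 0 i]] by simp
qed

lemma run_in_Q:
  assumes "wf_aut Sig Q Q0 delta" "is_run Q0 delta w r" "range w \<subseteq> Sig"
  shows "r i \<in> Q"
proof (induction i)
  case 0
  then show ?case using assms by (auto simp: is_run_def wf_aut_def)
next
  case (Suc i)
  moreover have "w i \<in> Sig" "r (Suc i) \<in> delta (r i) (w i)" using assms by (auto simp: is_run_def)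
  ultimately show ?case using assms(1) unfolding wf_aut_def by blast
qed

section \<open>Languages and residuals\<close>

lemma in_lang_iff:
  "w \<in> lang Sig Q0 delta acc \<longleftrightarrow> range w \<subseteq> Sig \<and> (\<exists>r. is_run Q0 delta w r \<and> acc (limit r))"
  by (auto simp: lang_def inf_set_eq_limit)

lemma lang_singleton_mono:
  "q \<in> Q0 \<Longrightarrow> lang Sig {q} delta acc \<subseteq> lang Sig Q0 delta acc"
  by (auto simp: in_lang_iff is_run_def)

lemma path_conc_lang:
  assumes "path delta q es q'" "snd ` set es \<subseteq> Sig" "w \<in> lang Sig {q'} delta acc"
  shows "map snd es \<frown> w \<in> lang Sig {q} delta acc"
proof -
  obtain r where "is_run {q'} delta w r" "acc (limit r)" "range w \<subseteq> Sig"
    using assms(3) by (auto simp: in_lang_iff)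
  then show ?thesis using path_conc_run[OF assms(1)] assms(2)
    by (auto simp: in_lang_iff intro!: exI[of _ "map fst es \<frown> r"])
qed

lemma loop_omega_in_lang:
  assumes "path delta q es q" "es \<noteq> []" "snd ` set es \<subseteq> Sig" "acc (fst ` set es)"
  shows "(map snd es)\<^sup>\<omega> \<in> lang Sig {q} delta acc"
  using path_omega[OF assms(1,2)] assms
  by (auto simp: in_lang_iff range_iter simp del: iter_nth intro!: exI[of _ "(map fst es)\<^sup>\<omega>"])

lemma strategy_run:
  assumes "is_gfg_strategy Sig Q0 delta acc g" "range w \<subseteq> Sig"
  shows "is_run Q0 delta w (\<lambda>i. g (prefix i w))"
  using assms by (auto simp: is_gfg_strategy_def pref_eq_prefix)

lemma strategy_accepts_iff:
  assumes "is_gfg_strategy Sig Q0 delta acc g" "range w \<subseteq> Sig"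
  shows "w \<in> lang Sig Q0 delta acc \<longleftrightarrow> acc (limit (\<lambda>i. g (prefix i w)))"
  using assms strategy_run[OF assms]
  by (auto simp: is_gfg_strategy_def pref_eq_prefix inf_set_eq_limit in_lang_iff)

text \<open>The run of the strategy on \<open>u \<frown> w\<close> is in \<open>g u\<close> after
  \<open>u\<close>. Its initial part can be glued before any accepting run from \<open>g u\<close>;
  conversely, if \<open>u \<frown> w\<close> is accepted, its tail is an accepting run from
  \<open>g u\<close>, since acceptance depends only on the limit.\<close>

lemma strategy_residual:
  assumes g: "is_gfg_strategy Sig Q0 delta acc g" and u: "set u \<subseteq> Sig" and w: "range w \<subseteq> Sig"
  shows "w \<in> lang Sig {g u} delta acc \<longleftrightarrow> u \<frown> w \<in> lang Sig Q0 delta acc"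
proof -
  define r where "r = (\<lambda>i. g (prefix i (u \<frown> w)))"
  have uw: "range (u \<frown> w) \<subseteq> Sig" using u w by simp
  have r: "is_run Q0 delta (u \<frown> w) r" unfolding r_def by (rule strategy_run[OF g uw])
  have ru: "r (length u) = g u" by (simp add: r_def)
  show ?thesis
  proof
    assume "w \<in> lang Sig {g u} delta acc"
    moreover have "path delta (r 0) ((labelled r (u \<frown> w)) [0 \<rightarrow> length u]) (g u)"
      using run_segment_path[OF r, of 0 "length u"] ru by simp
    moreover have "snd ` set ((labelled r (u \<frown> w)) [0 \<rightarrow> length u]) \<subseteq> Sig" using uw by auto
    ultimately have "map snd ((labelled r (u \<frown> w)) [0 \<rightarrow> length u]) \<frown> w \<in> lang Sig {r 0} delta acc"
      by (intro path_conc_lang)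
    then have "u \<frown> w \<in> lang Sig {r 0} delta acc" by simp
    then show "u \<frown> w \<in> lang Sig Q0 delta acc"
      using lang_singleton_mono[of "r 0" Q0] r by (auto simp: is_run_def)
  next
    assume "u \<frown> w \<in> lang Sig Q0 delta acc"
    then have "acc (limit (suffix (length u) r))"
      using strategy_accepts_iff[OF g uw] by (simp add: r_def)
    moreover have "is_run {g u} delta w (suffix (length u) r)"
    proof -
      have "r (Suc (length u + i)) \<in> delta (r (length u + i)) (w i)" for i
        using r by (simp add: is_run_def conc_def) (metis add_diff_cancel_left' not_add_less1)
      then show ?thesis using ru by (simp add: is_run_def)
    qed
    ultimately show "w \<in> lang Sig {g u} delta acc" using w by (auto simp: in_lang_iff)
  qed
qed

text \<open>Since the strategy uses every transition, no transition of the automaton loses words.\<close>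

lemma path_residual:
  assumes g: "is_gfg_strategy Sig Q0 delta acc g" and wf: "wf_aut Sig Q Q0 delta"
    and used: "\<forall>q\<in>Q. \<forall>a\<in>Sig. \<forall>q'\<in>delta q a. \<exists>u. set u \<subseteq> Sig \<and> g u = q \<and> g (u @ [a]) = q'"
    and w: "range w \<subseteq> Sig"
  shows "path delta q es q' \<Longrightarrow> q \<in> Q \<Longrightarrow> snd ` set es \<subseteq> Sig \<Longrightarrow>
    map snd es \<frown> w \<in> lang Sig {q} delta acc \<Longrightarrow> w \<in> lang Sig {q'} delta acc"
proof (induction es arbitrary: q)
  case (Cons e es)
  obtain a s where e: "e = (q, a)" and s: "s \<in> delta q a" "path delta s es q'"
    using Cons.prems(1) by (cases e) auto
  have a: "a \<in> Sig" using Cons.prems(3) e by simp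
  \<comment> \<open>A history on which the strategy takes just this transition: both residuals
    become residuals of the whole language, and the letter \<open>a\<close> moves from the word to
    the history.\<close>
  obtain u where u: "set u \<subseteq> Sig" "g u = q" "g (u @ [a]) = s"
    using used Cons.prems(2) a s(1) by blast
  have es: "range (map snd es \<frown> w) \<subseteq> Sig" using Cons.prems(3) w by auto
  have "u \<frown> (a # map snd es) \<frown> w \<in> lang Sig Q0 delta acc"
    using strategy_residual[OF g u(1), of "(a # map snd es) \<frown> w"] Cons.prems(3,4) e u(2) w a
    by auto
  then have "(u @ [a]) \<frown> map snd es \<frown> w \<in> lang Sig Q0 delta acc" by simp
  then have "map snd es \<frown> w \<in> lang Sig {s} delta acc"
    using strategy_residual[OF g, of "u @ [a]"] u a es by auto
  moreover have "s \<in> Q" using wf Cons.prems(2) a s(1) unfolding wf_aut_def by blast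
  ultimately show ?case using Cons.IH[OF s(2)] Cons.prems(3) by simp
qed simp

text \<open>An accepting run eventually avoids \<open>beta\<close>. Inside a later block v^N it
  repeats a state between two copies of v, and circling there forever reads v^omega without meeting
  \<open>beta\<close>. \<open>N\<close> depends only on the number of states, so it is uniform in
  \<open>x\<close> and \<open>c\<close>.\<close>

lemma cobuchi_pumping:
  assumes wf: "wf_aut Sig P P0 delta" and v: "v \<noteq> []"
  obtains N where "N > 0" "\<And>x c. x \<frown> (concat (replicate N v) @ c)\<^sup>\<omega> \<in> lang Sig P0 delta (cobuchi_acc beta)
    \<Longrightarrow> \<exists>k. x \<frown> concat (replicate k (concat (replicate N v) @ c)) \<frown> v\<^sup>\<omega> \<in> lang Sig P0 delta (cobuchi_acc beta)"
proof (rule that[of "Suc (card P)"])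
  fix x c
  define N where "N = Suc (card P)"
  define b where "b = concat (replicate N v) @ c"
  define W where "W = x \<frown> b\<^sup>\<omega>"
  assume "x \<frown> (concat (replicate (Suc (card P)) v) @ c)\<^sup>\<omega> \<in> lang Sig P0 delta (cobuchi_acc beta)"
  then obtain r where W: "range W \<subseteq> Sig" and r: "is_run P0 delta W r"
    and acc: "limit r \<inter> beta = {}"
    by (auto simp: in_lang_iff cobuchi_acc_def W_def b_def N_def)
  have bne: "b \<noteq> []" using v by (simp add: b_def N_def)
  have rP: "r n \<in> P" for n using run_in_Q[OF wf r W] .
  have finP: "finite P" using wf by (simp add: wf_aut_def)
  then have "finite (range r)" using rP by (meson finite_subset image_subsetI)
  then obtain n0 where n0: "\<And>n. n \<ge> n0 \<Longrightarrow> r n \<notin> beta"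
    using limit_inter_empty[of r beta] acc by (auto simp: MOST_nat_le)
  \<comment> \<open>Every block is nonempty, so \<open>n0\<close> of them carry the run past
    position \<open>n0\<close>, after which it avoids \<open>beta\<close>; \<open>n0\<close> is also
    the final witness for \<open>k\<close>.\<close>
  define y where "y = x @ concat (replicate n0 b)"
  have leny: "length y \<ge> n0"
  proof -
    have "length (concat (replicate n b)) \<ge> n" for n
      using bne by (induction n) (auto simp: Suc_le_eq neq_Nil_conv)
    then show ?thesis by (simp add: y_def trans_le_add2)
  qed
  \<comment> \<open>The state after \<open>t\<close> copies of \<open>v\<close> in the block that
    follows \<open>y\<close>. The values of \<open>t\<close> up to \<open>card P\<close> outnumber
    the states.\<close>
  define h where "h t = r (length y + t * length v)" for t
  have "\<not> inj_on h {0..card P}"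
  proof
    assume "inj_on h {0..card P}"
    moreover have "h ` {0..card P} \<subseteq> P" using rP by (auto simp: h_def)
    ultimately show False using card_inj_on_le[of h "{0..card P}" P] finP by simp
  qed
  then obtain s t where st: "s < t" "t \<le> card P" "h s = h t"
    by (metis atLeastAtMost_iff inj_onI linorder_neqE_nat)
  have lenp: "length (concat (replicate n v)) = n * length v" for n
    by (induction n) auto
  have bsplit: "b = concat (replicate s v) @ concat (replicate (t - s) v) @ concat (replicate (N - t) v) @ c"
  proof -
    have "N = s + ((t - s) + (N - t))" using st by (simp add: N_def)
    then show ?thesis by (metis append.assoc b_def concat_append replicate_add)
  qed
  define i j where "i = length y + s * length v" and "j = length y + t * length v"
  have ij: "i < j" using st v by (simp add: i_def j_def)
  have "W = y \<frown> b\<^sup>\<omega>"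
    using pow_conc_iter[OF bne, of n0] by (simp add: W_def y_def conc_conc[symmetric] del: conc_conc)
  then have "W = y \<frown> b \<frown> b\<^sup>\<omega>" using iter_unroll[of b] bne by simp
  then have Ws: "W = (y @ concat (replicate s v)) \<frown> concat (replicate (t - s) v) \<frown>
      (concat (replicate (N - t) v) @ c) \<frown> b\<^sup>\<omega>"
    by (subst (asm) bsplit) simp
  have leni: "length (y @ concat (replicate s v)) = i" by (simp add: i_def lenp)
  have lenj: "length (concat (replicate (t - s) v)) = j - i"
    by (simp add: lenp i_def j_def diff_mult_distrib)
  have W0: "W [0 \<rightarrow> i] = y @ concat (replicate s v)"
    using prefix_conc_length[of "y @ concat (replicate s v)"] Ws leni by metis
  have "suffix i W = concat (replicate (t - s) v) \<frown> (concat (replicate (N - t) v) @ c) \<frown> b\<^sup>\<omega>"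
    using suffix_conc_length[of "y @ concat (replicate s v)"] Ws leni by metis
  then have W1: "W [i \<rightarrow> j] = concat (replicate (t - s) v)"
    using prefix_conc_length lenj subsequence_prefix_suffix by metis
  have "r i = r j" using st(3) by (simp add: h_def i_def j_def)
  from run_lasso[OF r ij this]
  have run: "is_run P0 delta (y \<frown> concat (replicate s v) \<frown> (concat (replicate (t - s) v))\<^sup>\<omega>)
      (r [0 \<rightarrow> i] \<frown> (r [i \<rightarrow> j])\<^sup>\<omega>)"
    using r by (auto simp: is_run_def W0 W1)
  \<comment> \<open>The loop reads a power of \<open>v\<close>, so its repetition is v^omega, which
    also absorbs the \<open>s\<close> copies read before it.\<close>
  have "(concat (replicate (t - s) v))\<^sup>\<omega> = v\<^sup>\<omega>" using iter_pow[OF v] st(1) by simp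
  then have run: "is_run P0 delta (y \<frown> v\<^sup>\<omega>) (r [0 \<rightarrow> i] \<frown> (r [i \<rightarrow> j])\<^sup>\<omega>)"
    using run pow_conc_iter[OF v, of s] by metis
  have "limit (r [0 \<rightarrow> i] \<frown> (r [i \<rightarrow> j])\<^sup>\<omega>) = r ` {i..<j}" using ij by simp
  moreover have "r ` {i..<j} \<inter> beta = {}" using n0 leny by (auto simp: i_def)
  moreover have "range (y \<frown> v\<^sup>\<omega>) \<subseteq> Sig"
  proof -
    have "set b \<subseteq> Sig" "set x \<subseteq> Sig" using W bne by (auto simp: W_def range_iter simp del: iter_nth)
    moreover have "set v \<subseteq> set b" by (simp add: b_def N_def)
    ultimately show ?thesis using v by (auto simp: y_def range_iter simp del: iter_nth)
  qed
  ultimately have "y \<frown> v\<^sup>\<omega> \<in> lang Sig P0 delta (cobuchi_acc beta)"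
    using run by (auto simp: in_lang_iff cobuchi_acc_def intro!: exI[of _ "r [0 \<rightarrow> i] \<frown> (r [i \<rightarrow> j])\<^sup>\<omega>"])
  then show "\<exists>k. x \<frown> concat (replicate k (concat (replicate (Suc (card P)) v) @ c)) \<frown> v\<^sup>\<omega>
      \<in> lang Sig P0 delta (cobuchi_acc beta)"
    by (auto simp: y_def b_def N_def intro!: exI[of _ n0])
qed simp

section \<open>Accepting loops\<close>

lemma streett_acc_empty: "streett_acc alpha {}"
  by (auto simp: streett_acc_def)

text \<open>If the union meets E, then one of the two sets does, and that set already meets F. This
  closure under union is what makes detours through accepting loops work.\<close>

lemma streett_acc_Un: "streett_acc alpha S \<Longrightarrow> streett_acc alpha T \<Longrightarrow> streett_acc alpha (S \<union> T)"
  by (fastforce simp: streett_acc_def)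

definition accepting_loop ::
  "'a set \<Rightarrow> ('q \<Rightarrow> 'a \<Rightarrow> 'q set) \<Rightarrow> ('q set \<times> 'q set) set \<Rightarrow> 'q \<Rightarrow> ('q \<times> 'a) list \<Rightarrow> bool" where
  "accepting_loop Sig delta alpha q es \<longleftrightarrow> es \<noteq> [] \<and> path delta q es q \<and>
     snd ` set es \<subseteq> Sig \<and> streett_acc alpha (fst ` set es)"

text \<open>Before each transition, insert an accepting loop at its source. The states visited are
  then the union of those of the inserted loops, and this union is accepting.\<close>

lemma accepting_detour:
  assumes "path delta q es q'" "snd ` set es \<subseteq> Sig"
    and "\<forall>p\<in>fst ` set es. \<exists>ys. accepting_loop Sig delta alpha p ys"
  shows "\<exists>cs. path delta q cs q' \<and> snd ` set cs \<subseteq> Sig \<and> fst ` set es \<subseteq> fst ` set cs \<and>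
    streett_acc alpha (fst ` set cs)"
  using assms
proof (induction es arbitrary: q)
  case Nil
  then show ?case by (intro exI[of _ "[]"]) (simp add: streett_acc_empty)
next
  case (Cons e es)
  obtain a s where e: "e = (q, a)" and s: "s \<in> delta q a" "path delta s es q'"
    using Cons.prems(1) by (cases e) auto
  obtain ys where ys: "accepting_loop Sig delta alpha q ys" using Cons.prems(3) e by auto
  obtain cs where cs: "path delta s cs q'" "snd ` set cs \<subseteq> Sig" "fst ` set es \<subseteq> fst ` set cs"
    "streett_acc alpha (fst ` set cs)"
    using Cons.IH[OF s(2)] Cons.prems by auto
  \<comment> \<open>The loop starts in \<open>q\<close>, so taking the transition from
    \<open>q\<close> afterwards adds no state to the union.\<close>
  have "q \<in> fst ` set ys"
    using ys path_hd[of delta q ys q] by (force simp: accepting_loop_def)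
  then have set_eq: "fst ` set (ys @ (q, a) # cs) = fst ` set ys \<union> fst ` set cs" by auto
  have "streett_acc alpha (fst ` set (ys @ (q, a) # cs))"
    unfolding set_eq using ys cs by (intro streett_acc_Un) (auto simp: accepting_loop_def)
  then show ?case
    using ys cs s(1) Cons.prems(2) e \<open>q \<in> fst ` set ys\<close>
    by (intro exI[of _ "ys @ (q, a) # cs"]) (auto simp: path_append accepting_loop_def)
qed

text \<open>A segment of the run between two visits to \<open>q\<close> can be chosen to visit
  exactly the states of \<open>limit r\<close>, so it is itself an accepting loop.\<close>

lemma limit_accepting_loop:
  assumes wf: "wf_aut Sig Q Q0 delta" and r: "is_run Q0 delta w r" and w: "range w \<subseteq> Sig"
    and acc: "streett_acc alpha (limit r)" and q: "q \<in> limit r"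
  shows "\<exists>es. accepting_loop Sig delta alpha q es"
proof -
  have "finite (range r)"
    using run_in_Q[OF wf r w] wf by (meson finite_subset image_subsetI wf_aut_def)
  then obtain i j where ij: "i < j" "r i = q" "r j = q" "r ` {i..<j} = limit r"
    using limit_return q by metis
  have "fst ` set ((labelled r w) [i \<rightarrow> j]) = limit r" using ij(4) by (simp add: image_image)
  then show ?thesis
    using run_segment_path[OF r, of i j] ij acc w
    by (intro exI[of _ "(labelled r w) [i \<rightarrow> j]"]) (auto simp: accepting_loop_def)
qed

section \<open>Co-Buechi typeness\<close>

definition no_accepting_loop ::
  "'a set \<Rightarrow> 'q set \<Rightarrow> ('q \<Rightarrow> 'a \<Rightarrow> 'q set) \<Rightarrow> ('q set \<times> 'q set) set \<Rightarrow> 'q set" where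
  "no_accepting_loop Sig Q delta alpha = {q\<in>Q. \<nexists>es. accepting_loop Sig delta alpha q es}"

lemma streett_imp_cobuchi:
  assumes "wf_aut Sig Q Q0 delta" "is_run Q0 delta w r" "range w \<subseteq> Sig"
    and "streett_acc alpha (limit r)"
  shows "cobuchi_acc (no_accepting_loop Sig Q delta alpha) (limit r)"
  using limit_accepting_loop[OF assms] by (auto simp: cobuchi_acc_def no_accepting_loop_def)

text \<open>The memory update is written as an automaton with singleton successor sets, so that
  facts about runs apply to it; determinism makes its run unique.\<close>

lemma run_foldl:
  assumes "is_run {m0} (\<lambda>m a. {rho m a}) w r"
  shows "foldl rho m0 (prefix n w) = r n"
  using assms by (induction n) (auto simp: is_run_def)

lemma foldl_run: "is_run {m0} (\<lambda>m a. {rho m a}) w (\<lambda>n. foldl rho m0 (prefix n w))"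
  by (auto simp: is_run_def)

lemma loop_omega_in_residual:
  assumes g: "is_gfg_strategy Sig Q0 delta (streett_acc alpha) g" and wf: "wf_aut Sig Q Q0 delta"
    and used: "\<forall>q\<in>Q. \<forall>a\<in>Sig. \<forall>q'\<in>delta q a. \<exists>u. set u \<subseteq> Sig \<and> g u = q \<and> g (u @ [a]) = q'"
    and wfB: "wf_aut Sig P P0 deltaB"
    and langB: "lang Sig P0 deltaB (cobuchi_acc beta) = lang Sig Q0 delta (streett_acc alpha)"
    and vs: "vs \<noteq> []" "path delta q vs q" "snd ` set vs \<subseteq> Sig" "fst ` set vs \<subseteq> Q"
    and good: "\<forall>p\<in>fst ` set vs. \<exists>ys. accepting_loop Sig delta alpha p ys"
  shows "(map snd vs)\<^sup>\<omega> \<in> lang Sig {q} delta (streett_acc alpha)"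
proof -
  let ?L = "\<lambda>q. lang Sig {q} delta (streett_acc alpha)"
  define v where "v = map snd vs"
  have v: "v \<noteq> []" using vs(1) by (simp add: v_def)
  obtain a vs' where vs_eq: "vs = (q, a) # vs'"
    using vs(1,2) by (cases vs) auto
  \<comment> \<open>The first transition of the loop leaves \<open>q\<close>; since the strategy
    uses it, some history \<open>u\<close> leads the strategy to \<open>q\<close>.\<close>
  then have qQ: "q \<in> Q" and "\<exists>s\<in>delta q a. True" and "a \<in> Sig" using vs by auto
  then obtain u where u: "set u \<subseteq> Sig" "g u = q" using used by blast
  obtain cs where cs: "path delta q cs q" "snd ` set cs \<subseteq> Sig" "fst ` set vs \<subseteq> fst ` set cs"
    "streett_acc alpha (fst ` set cs)"
    using accepting_detour[OF vs(2,3) good] by blast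
  obtain N where N: "N > 0" "\<And>x c. x \<frown> (concat (replicate N v) @ c)\<^sup>\<omega> \<in> lang Sig P0 deltaB (cobuchi_acc beta)
    \<Longrightarrow> \<exists>k. x \<frown> concat (replicate k (concat (replicate N v) @ c)) \<frown> v\<^sup>\<omega> \<in> lang Sig P0 deltaB (cobuchi_acc beta)"
    using cobuchi_pumping[OF wfB v] by blast
  define bs where "bs = concat (replicate N vs) @ cs"
  have bs: "path delta q bs q" "bs \<noteq> []" "snd ` set bs \<subseteq> Sig"
    using path_pow[OF vs(2), of N] cs vs N(1) by (auto simp: bs_def path_append)
  \<comment> \<open>The detour covers all states of \<open>vs\<close>, so prepending copies of
    \<open>vs\<close> leaves the accepting state set unchanged.\<close>
  have fst_bs: "fst ` set bs = fst ` set cs" using cs(3) N(1) by (auto simp: bs_def)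
  have snd_bs: "map snd bs = concat (replicate N v) @ map snd cs"
    by (simp add: bs_def v_def map_concat)
  have bs_range: "range ((map snd bs)\<^sup>\<omega>) \<subseteq> Sig" using bs(2,3) by (simp add: range_iter del: iter_nth)
  have v_range: "range (v\<^sup>\<omega>) \<subseteq> Sig" using v vs(3) by (simp add: v_def range_iter del: iter_nth)
  have "(map snd bs)\<^sup>\<omega> \<in> ?L q"
    using loop_omega_in_lang[OF bs] fst_bs cs(4) by metis
  \<comment> \<open>The two automata share only their language, so the word is prefixed with
    \<open>u\<close> before it is passed to the co-Buechi automaton.\<close>
  then have "u \<frown> (map snd bs)\<^sup>\<omega> \<in> lang Sig P0 deltaB (cobuchi_acc beta)"
    using strategy_residual[OF g u(1) bs_range] u(2) langB by simp
  then obtain k where k: "u \<frown> concat (replicate k (map snd bs)) \<frown> v\<^sup>\<omega> \<in> lang Sig Q0 delta (streett_acc alpha)"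
    using N(2) unfolding snd_bs langB by metis
  \<comment> \<open>The pumped blocks label a loop from \<open>q\<close> back to \<open>q\<close>;
    since transitions preserve residuals, they can be stripped off, leaving v^omega accepted from
    \<open>q\<close>.\<close>
  define ks where "ks = concat (replicate k bs)"
  have ks: "path delta q ks q" "snd ` set ks \<subseteq> Sig" "map snd ks = concat (replicate k (map snd bs))"
    using path_pow[OF bs(1)] bs(3) by (force simp: ks_def map_concat)+
  have "range (map snd ks \<frown> v\<^sup>\<omega>) \<subseteq> Sig" using ks(2) v_range by auto
  then have "map snd ks \<frown> v\<^sup>\<omega> \<in> ?L q"
    using k strategy_residual[OF g u(1)] u(2) unfolding ks(3) by blast
  then show ?thesis
    using path_residual[OF g wf used v_range ks(1) qQ ks(2)] by (simp add: v_def)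
qed

lemma cobuchi_imp_streett:
  assumes tr: "transducer Sig Q M m0 rho tau"
    and g: "is_gfg_strategy Sig Q0 delta (streett_acc alpha) (strat m0 rho tau)"
    and wf: "wf_aut Sig Q Q0 delta"
    and used: "\<forall>q\<in>Q. \<forall>a\<in>Sig. \<forall>q'\<in>delta q a. \<exists>u. set u \<subseteq> Sig \<and>
           strat m0 rho tau u = q \<and> strat m0 rho tau (u @ [a]) = q'"
    and wfB: "wf_aut Sig P P0 deltaB"
    and langB: "lang Sig P0 deltaB (cobuchi_acc beta) = lang Sig Q0 delta (streett_acc alpha)"
    and r: "is_run Q0 delta w r" and w: "range w \<subseteq> Sig"
    and acc: "cobuchi_acc (no_accepting_loop Sig Q delta alpha) (limit r)"
  shows "w \<in> lang Sig Q0 delta (streett_acc alpha)"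
proof (rule ccontr)
  assume notin: "w \<notin> lang Sig Q0 delta (streett_acc alpha)"
  let ?step = "\<lambda>m a. {rho m a}"
  define mu where "mu n = foldl rho m0 (prefix n w)" for n
  have mu: "is_run {m0} ?step w mu" unfolding mu_def by (rule foldl_run)
  have muM: "mu n \<in> M" for n
    using tr w by (induction n) (auto simp: mu_def transducer_def)
  have rQ: "r n \<in> Q" for n using run_in_Q[OF wf r w] .
  \<comment> \<open>Tracking run and memory jointly yields one pair \<open>i < j\<close> at which
    both return, with each visiting exactly its limit set in between.\<close>
  define x where "x n = (r n, mu n, w n)" for n
  have "range x \<subseteq> Q \<times> M \<times> Sig" using rQ muM w by (auto simp: x_def)
  moreover have "finite (Q \<times> M \<times> Sig)" using tr wf by (simp add: transducer_def wf_aut_def)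
  ultimately have fin: "finite (range x)" by (rule finite_subset)
  then obtain e where "e \<in> limit x" using limit_nonempty by blast
  then obtain i j where ij: "i < j" "x i = x j" "x ` {i..<j} = limit x"
    using limit_return[OF fin] by metis
  have r_lim: "r ` {i..<j} = limit r"
    using limit_comp_finite[OF fin, of fst] ij(3)[symmetric] by (simp add: image_image comp_def x_def)
  have mu_lim: "mu ` {i..<j} = limit mu"
    using limit_comp_finite[OF fin, of "fst \<circ> snd"] ij(3)[symmetric]
    by (simp add: image_image comp_def x_def)
  define W where "W = w [0 \<rightarrow> i] \<frown> (w [i \<rightarrow> j])\<^sup>\<omega>"
  have W: "range W \<subseteq> Sig" using w ij(1) by (auto simp: W_def range_iter simp del: iter_nth)

  \<comment> \<open>On the lasso word \<open>W\<close> the memory cycles through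
    \<open>limit mu\<close>, so the strategy has the same infinity set as on \<open>w\<close> and
    rejects \<open>W\<close> too.\<close>
  have "is_run {m0} ?step W (mu [0 \<rightarrow> i] \<frown> (mu [i \<rightarrow> j])\<^sup>\<omega>)"
    using run_lasso[OF mu ij(1)] ij(2) by (simp add: W_def x_def mu_def)
  from run_foldl[OF this] have "(\<lambda>n. strat m0 rho tau (prefix n W)) =
      tau \<circ> (mu [0 \<rightarrow> i] \<frown> (mu [i \<rightarrow> j])\<^sup>\<omega>)"
    by (simp add: strat_def comp_def)
  moreover have "limit (tau \<circ> (mu [0 \<rightarrow> i] \<frown> (mu [i \<rightarrow> j])\<^sup>\<omega>)) = tau ` limit mu"
    using ij(1) by (subst limit_comp_finite) (simp_all add: range_iter mu_lim[symmetric] del: iter_nth comp_concat)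
  moreover have "limit (\<lambda>n. strat m0 rho tau (prefix n w)) = tau ` limit mu"
  proof -
    have "finite (range mu)" using muM tr by (meson finite_subset image_subsetI transducer_def)
    then show ?thesis using limit_comp_finite[of mu tau] by (simp add: strat_def mu_def comp_def)
  qed
  ultimately have "W \<notin> lang Sig Q0 delta (streett_acc alpha)"
    using notin strategy_accepts_iff[OF g w] strategy_accepts_iff[OF g W] by simp

  moreover have "W \<in> lang Sig Q0 delta (streett_acc alpha)"
  proof -
    \<comment> \<open>The run \<open>r\<close> closes a loop on the same segment. Its states form
      \<open>limit r\<close>, which avoids the new condition, so each of them lies on an accepting
      loop.\<close>
    define vs where "vs = (labelled r w) [i \<rightarrow> j]"
    have fst_vs: "fst ` set vs = limit r" by (simp add: vs_def image_image r_lim)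
    have "path delta (r i) vs (r i)"
      using run_segment_path[OF r, of i j] ij by (simp add: vs_def x_def)
    moreover have "\<forall>p\<in>fst ` set vs. \<exists>ys. accepting_loop Sig delta alpha p ys"
    proof
      fix p assume "p \<in> fst ` set vs"
      then have "p \<in> limit r" by (simp only: fst_vs)
      moreover have "limit r \<subseteq> Q" using rQ by (auto simp flip: r_lim)
      ultimately show "\<exists>ys. accepting_loop Sig delta alpha p ys"
        using acc by (auto simp: cobuchi_acc_def no_accepting_loop_def)
    qed
    moreover have "snd ` set vs \<subseteq> Sig" "fst ` set vs \<subseteq> Q" "vs \<noteq> []"
      using w rQ ij(1) by (auto simp: vs_def)
    ultimately have "(map snd vs)\<^sup>\<omega> \<in> lang Sig {r i} delta (streett_acc alpha)"
      by (intro loop_omega_in_residual[OF g wf used wfB langB])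
    then have "(w [i \<rightarrow> j])\<^sup>\<omega> \<in> lang Sig {r i} delta (streett_acc alpha)"
      by (simp add: vs_def)
    moreover have "snd ` set ((labelled r w) [0 \<rightarrow> i]) \<subseteq> Sig" using w by auto
    ultimately have "W \<in> lang Sig {r 0} delta (streett_acc alpha)"
      using path_conc_lang[OF run_segment_path[OF r, of 0 i]] by (simp add: W_def)
    then show ?thesis using lang_singleton_mono[of "r 0" Q0] r by (auto simp: is_run_def)
  qed
  ultimately show False by blast
qed

theorem theorem10:
  fixes Sig :: "'a set" and Q Q0 :: "'q set" and delta :: "'q \<Rightarrow> 'a \<Rightarrow> 'q set"
    and alpha :: "('q set \<times> 'q set) set"
  assumes "wf_aut Sig Q Q0 delta"
    and "finite alpha" and "\<forall>(E, F)\<in>alpha. E \<subseteq> Q \<and> F \<subseteq> Q"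
    and "gfg Sig Q0 delta (streett_acc alpha)"
    and "tight Sig Q Q0 delta alpha"
    and "\<exists>(P :: 'p set) P0 deltaB beta. wf_aut Sig P P0 deltaB \<and> beta \<subseteq> P \<and>
           gfg Sig P0 deltaB (cobuchi_acc beta) \<and>
           lang Sig P0 deltaB (cobuchi_acc beta) = lang Sig Q0 delta (streett_acc alpha)"
  shows "\<exists>alpha' \<subseteq> Q. gfg Sig Q0 delta (cobuchi_acc alpha') \<and>
           lang Sig Q0 delta (cobuchi_acc alpha') = lang Sig Q0 delta (streett_acc alpha)"
proof -
  let ?alpha' = "no_accepting_loop Sig Q delta alpha"
  note wf = assms(1)
  obtain M m0 rho tau where tr: "transducer Sig Q M m0 rho tau"
    and g: "is_gfg_strategy Sig Q0 delta (streett_acc alpha) (strat m0 rho tau)"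
    and used: "\<forall>q\<in>Q. \<forall>a\<in>Sig. \<forall>q'\<in>delta q a. \<exists>u. set u \<subseteq> Sig \<and>
           strat m0 rho tau u = q \<and> strat m0 rho tau (u @ [a]) = q'"
    using assms(5) unfolding tight_def by blast
  obtain P :: "'p set" and P0 deltaB beta where wfB: "wf_aut Sig P P0 deltaB"
    and langB: "lang Sig P0 deltaB (cobuchi_acc beta) = lang Sig Q0 delta (streett_acc alpha)"
    using assms(6) by blast
  \<comment> \<open>Both inclusions keep the accepting run in hand arbitrary; the first passes
    through the behaviour of the strategy on the same word, the second reuses the same run.\<close>
  have eq: "lang Sig Q0 delta (cobuchi_acc ?alpha') = lang Sig Q0 delta (streett_acc alpha)"
  proof
    show "lang Sig Q0 delta (cobuchi_acc ?alpha') \<subseteq> lang Sig Q0 delta (streett_acc alpha)"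
      using cobuchi_imp_streett[OF tr g wf used wfB langB] unfolding in_lang_iff subset_iff by blast
    show "lang Sig Q0 delta (streett_acc alpha) \<subseteq> lang Sig Q0 delta (cobuchi_acc ?alpha')"
      using streett_imp_cobuchi[OF wf] unfolding in_lang_iff subset_iff by blast
  qed
  \<comment> \<open>The same strategy serves: on words of the common language its run is Streett
    accepting, hence its limit consists of states on accepting loops.\<close>
  have "is_gfg_strategy Sig Q0 delta (cobuchi_acc ?alpha') (strat m0 rho tau)"
    unfolding is_gfg_strategy_def eq
  proof (intro allI impI conjI)
    fix w :: "nat \<Rightarrow> 'a" assume "\<forall>i. w i \<in> Sig"
    then have w: "range w \<subseteq> Sig" by blast
    show run: "is_run Q0 delta w (\<lambda>i. strat m0 rho tau (pref w i))"
      using strategy_run[OF g w] by (simp add: pref_eq_prefix)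
    assume "w \<in> lang Sig Q0 delta (streett_acc alpha)"
    then show "cobuchi_acc ?alpha' (inf_set (\<lambda>i. strat m0 rho tau (pref w i)))"
      using streett_imp_cobuchi[OF wf run w] strategy_accepts_iff[OF g w]
      by (simp add: inf_set_eq_limit pref_eq_prefix)
  qed
  moreover have "?alpha' \<subseteq> Q" by (auto simp: no_accepting_loop_def)
  ultimately show ?thesis using eq unfolding gfg_def by blast
qed

end
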